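(* Let $\lambda$ be any partition, written in Frobenius notation as $\lambda=(\alpha|\beta)=(\alpha_1\cdots\alpha_r|\beta_1\cdots\beta_r)$, and let $s_{(\alpha|\beta)}=s_\lambda$ be the generalized Schur function of $\lambda$. Then for every $n\ge l(\lambda)$, $$s_{(\alpha|\beta)}=\det\left[s_{(\lambda_i-i\,|\,n-j)}\right]_{1\le i,j\le n}=\det\left[s_{(\alpha_i|\beta_j)}\right]_{1\le i,j\le r},$$ where the entries $s_{(a|b)}$ are the hook Schur functions.
   Context: Setting. Let $B=\mathbb C[h^{(0)}_1,h^{(0)}_2,\dots]$ be the polynomial ring in independent variables $h^{(0)}_k$ ($k>0$), with $h^{(0)}_0=1$ and $h^{(0)}_k=0$ for $k<0$. $B$ is graded by $\deg h^{(0)}_n=n$, and $B^{\le n}$ is the sum of the homogeneous components of degree $\le n$. Let $\{h^{(r)}_k\}_{k,r\in\mathbb Z}$ be a family of elements of $B$ (extending the $h^{(0)}_k$) with $h^{(r)}_k\in B^{\le k+r}$, $h^{(k)}_{-k}=1$ for all $k\in\mathbb Z$, and $h^{(r)}_k=0$ whenever $k+r<0$. For a partition $\lambda=(\lambda_1\ge\dots\ge\lambda_l\ge0)$ the generalized Schur function is $$s_\lambda=\det\left[h^{(j-1)}_{\lambda_i-i+1}\right]_{1\le i,j\le l}$$ (independent of appending zero parts). It is required that the $s_\lambda$, $\lambda$ ranging over all partitions, form a linear basis of $B$. Generalized elementary symmetric functions: for $a,p\in\mathbb Z$, $e^{(p)}_a=0$ if $p<a$, $e^{(p)}_a=1$ if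 $p=a$, and $e^{(p)}_a=\det\left[h^{(-p+j)}_{p+1-i}\right]_{1\le i,j\le p-a}$ if $p>a$. Hook Schur functions: for $m,n\in\mathbb Z$, $$s_{(m|n)}=\sum_{p=0}^{n}(-1)^p\,h^{(p)}_{m+1}\,e^{(-p)}_{-n}.$$ (For $m,n\ge0$ this is the generalized Schur function $s_{(m+1,1^n)}$ of the hook $(m+1,1^n)$.) Frobenius notation: if $\lambda'$ is the conjugate of $\lambda$ and $r$ is the length of the main diagonal of $\lambda$, then $\alpha_i=\lambda_i-i$ and $\beta_i=\lambda'_i-i$ for $1\le i\le r$. $l(\lambda)$ is the number of nonzero parts, and $\lambda_i=0$ for $i>l(\lambda)$. *)

theory Defs
  imports "HOL-Library.Poly_Mapping" "Jordan_Normal_Form.Determinant"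
begin

text \<open>
  The ring \<open>B = \<complex>[h\<^sub>1, h\<^sub>2, \<dots>]\<close>: a monomial is a finitely supported exponent function on \<open>nat\<close>,
  a polynomial a finitely supported function from monomials to the coefficients.
  The indeterminate with index \<open>i :: nat\<close> is \<open>h\<close> with subscript \<open>i + 1\<close>, so that there is no
  superfluous variable for subscript \<open>0\<close> and \<open>B\<close> is the full type.
\<close>

type_synonym B = "(nat \<Rightarrow>\<^sub>0 nat) \<Rightarrow>\<^sub>0 complex"

definition hgen :: "int \<Rightarrow> B" where
  "hgen k = (if k < 0 then 0 else if k = 0 then 1
             else Poly_Mapping.single (Poly_Mapping.single (nat k - 1) 1) 1)"

definition scaleB :: "complex \<Rightarrow> B \<Rightarrow> B" where
  "scaleB c f = Poly_Mapping.single 0 c * f"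

global_interpretation B: Vector_Spaces.vector_space scaleB
proof
  fix a b :: complex and x y :: B
  show "scaleB a (x + y) = scaleB a x + scaleB a y"
    by (simp add: scaleB_def distrib_left)
  show "scaleB (a + b) x = scaleB a x + scaleB b x"
    by (simp add: scaleB_def single_add distrib_right)
  show "scaleB a (scaleB b x) = scaleB (a * b) x"
    by (simp add: scaleB_def mult_single flip: mult.assoc)
  show "scaleB 1 x = x"
    by (simp add: scaleB_def)
qed

text \<open>The grading in which \<open>hgen n\<close> has degree \<open>n\<close>.\<close>

definition mdeg :: "(nat \<Rightarrow>\<^sub>0 nat) \<Rightarrow> nat" where
  "mdeg m = (\<Sum>i\<in>Poly_Mapping.keys m. (i + 1) * Poly_Mapping.lookup m i)"

definition homog :: "nat \<Rightarrow> B set" where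
  "homog d = {f. \<forall>m\<in>Poly_Mapping.keys f. mdeg m = d}"

definition B_le :: "int \<Rightarrow> B set" where
  "B_le n = {\<Sum>d | int d \<le> n. g d |g. \<forall>d. g d \<in> homog d}"

text \<open>A family is a linear basis: the members are pairwise distinct and form a basis as a set.\<close>

definition basis_family :: "('i \<Rightarrow> B) \<Rightarrow> 'i set \<Rightarrow> bool" where
  "basis_family b I \<longleftrightarrow> inj_on b I \<and> B.independent (b ` I) \<and> B.span (b ` I) = UNIV"

text \<open>
  Partitions are represented by the weakly decreasing list of their nonzero parts, so that
  \<open>length\<close> is the number of nonzero parts; \<open>part\<close> is indexed from \<open>1\<close>.
\<close>

definition is_partition :: "nat list \<Rightarrow> bool" where
  "is_partition lam \<longleftrightarrow> sorted_wrt (\<ge>) lam \<and> 0 \<notin> set lam"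

definition part :: "nat list \<Rightarrow> nat \<Rightarrow> nat" where
  "part lam i = (if 1 \<le> i \<and> i \<le> length lam then lam ! (i - 1) else 0)"

definition conj_part :: "nat list \<Rightarrow> nat \<Rightarrow> nat" where
  "conj_part lam j = card {i. 1 \<le> i \<and> i \<le> length lam \<and> j \<le> part lam i}"

definition diag_length :: "nat list \<Rightarrow> nat" where
  "diag_length lam = card {i. 1 \<le> i \<and> i \<le> part lam i}"

definition frob_arm :: "nat list \<Rightarrow> nat \<Rightarrow> int" where
  "frob_arm lam i = int (part lam i) - int i"

definition frob_leg :: "nat list \<Rightarrow> nat \<Rightarrow> int" where
  "frob_leg lam j = int (conj_part lam j) - int j"

text \<open>\<open>det1 n a\<close> is the determinant of \<open>a i j\<close> for \<open>1 \<le> i, j \<le> n\<close>; it is \<open>1\<close> for \<open>n = 0\<close>.\<close>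

definition det1 :: "nat \<Rightarrow> (nat \<Rightarrow> nat \<Rightarrow> B) \<Rightarrow> B" where
  "det1 n a = det (mat n n (\<lambda>(i, j). a (i + 1) (j + 1)))"

text \<open>In the following \<open>h r k\<close> stands for \<open>h\<close> with superscript \<open>(r)\<close> and subscript \<open>k\<close>,
  and \<open>gen_elem h p a\<close> for \<open>e\<close> with superscript \<open>(p)\<close> and subscript \<open>a\<close>.\<close>

definition gen_schur :: "(int \<Rightarrow> int \<Rightarrow> B) \<Rightarrow> nat list \<Rightarrow> B" where
  "gen_schur h lam =
     det1 (length lam) (\<lambda>i j. h (int j - 1) (int (part lam i) - int i + 1))"

definition gen_elem :: "(int \<Rightarrow> int \<Rightarrow> B) \<Rightarrow> int \<Rightarrow> int \<Rightarrow> B" where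
  "gen_elem h p a =
     (if p < a then 0 else if p = a then 1
      else det1 (nat (p - a)) (\<lambda>i j. h (- p + int j) (p + 1 - int i)))"

definition hook_schur :: "(int \<Rightarrow> int \<Rightarrow> B) \<Rightarrow> int \<Rightarrow> int \<Rightarrow> B" where
  "hook_schur h m n = (\<Sum>p\<in>{0..n}. (-1) ^ nat p * h p (m + 1) * gen_elem h (- p) (- n))"

end

theory Submission
  imports Defs
begin

text \<open>
  Put \<open>U a b = h b (- a)\<close>: an upper unitriangular matrix indexed by the integers, whose inverse
  has the entries \<open>(-1)^(q-p) * gen_elem h (-p) (-q)\<close>. Hence the matrix of hook functions in the
  first determinant is the matrix of the Schur function times an anti-triangular matrix of
  determinant \<open>1\<close>, and \<open>hook_schur h m q\<close> with \<open>m < 0\<close> is \<open>(-1)^q\<close> if \<open>q = -m - 1\<close> and \<open>0\<close>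
  otherwise. The second determinant is obtained from the first by expanding along the last row
  as long as its index exceeds the length of the diagonal: if \<open>k\<close> rows are left, then the surviving
  columns are those with \<open>q = max k \<lambda>'\<^sub>j - j\<close> for \<open>1 \<le> j \<le> k\<close>, row \<open>k\<close> has its only nonzero entry
  in column \<open>\<lambda>\<^sub>k + 1\<close>, and the signs cancel in each step.
\<close>

section \<open>Determinants with indices from 1\<close>

lemma det1_cong:
  assumes "\<And>i j. 1 \<le> i \<Longrightarrow> i \<le> n \<Longrightarrow> 1 \<le> j \<Longrightarrow> j \<le> n \<Longrightarrow> a i j = b i j"
  shows "det1 n a = det1 n b"
  unfolding det1_def by (rule arg_cong[of _ _ det], rule eq_matI) (auto intro: assms)

lemma det1_0 [simp]: "det1 0 a = 1"
  by (simp add: det1_def)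

lemma det1_Suc_0 [simp]: "det1 (Suc 0) a = a 1 1"
  by (simp add: det1_def det_single)

text \<open>Laplace expansion along the last row; the \<open>if\<close> closes the gap left by the
  deleted column \<open>c\<close>.\<close>

lemma det1_last_row_single:
  assumes c: "1 \<le> c" "c \<le> Suc k"
    and zero: "\<And>j. 1 \<le> j \<Longrightarrow> j \<le> Suc k \<Longrightarrow> j \<noteq> c \<Longrightarrow> a (Suc k) j = 0"
  shows "det1 (Suc k) a =
    (-1) ^ (Suc k + c) * a (Suc k) c * det1 k (\<lambda>i j. a i (if j < c then j else Suc j))"
proof -
  define A where "A = mat (Suc k) (Suc k) (\<lambda>(i, j). a (i + 1) (j + 1))"
  have "det A = (\<Sum>j<Suc k. A $$ (k, j) * cofactor A k j)"
    by (rule laplace_expansion_row[of _ "Suc k"]) (auto simp: A_def)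
  also have "\<dots> = (\<Sum>j\<in>{c - 1}. A $$ (k, j) * cofactor A k j)"
    by (rule sum.mono_neutral_right) (use c zero in \<open>auto simp: A_def\<close>)
  also have "\<dots> = a (Suc k) c * cofactor A k (c - 1)"
    using c by (simp add: A_def)
  also have "cofactor A k (c - 1) =
      (-1) ^ (Suc k + c) * det1 k (\<lambda>i j. a i (if j < c then j else Suc j))"
  proof -
    have "mat_delete A k (c - 1) =
        mat k k (\<lambda>(i, j). a (i + 1) (if j + 1 < c then j + 1 else Suc (j + 1)))"
      by (rule eq_matI) (use c in \<open>auto simp: A_def mat_delete_def\<close>)
    \<comment> \<open>Passing from indices starting at 0 to indices starting at 1 changes the
      exponent by 2.\<close>
    moreover have "(-1) ^ (k + (c - 1)) = ((-1) ^ (Suc k + c) :: B)"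
      using c by (cases c) auto
    ultimately show ?thesis
      by (simp add: cofactor_def det1_def cong: if_cong)
  qed
  finally show ?thesis
    by (simp add: det1_def A_def mult_ac)
qed

text \<open>Made for matrices that are Hessenberg apart from an arbitrary first row: the second
  minor deletes row 2, so that first row survives.\<close>

lemma det1_first_column_two:
  assumes "\<And>i. 3 \<le> i \<Longrightarrow> i \<le> Suc (Suc m) \<Longrightarrow> a i 1 = 0"
  shows "det1 (Suc (Suc m)) a =
    a 1 1 * det1 (Suc m) (\<lambda>i j. a (Suc i) (Suc j)) -
    a 2 1 * det1 (Suc m) (\<lambda>i j. a (if i = 1 then 1 else Suc i) (Suc j))"
proof -
  let ?n = "Suc (Suc m)"
  define A where "A = mat ?n ?n (\<lambda>(i, j). a (i + 1) (j + 1))"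
  have "det A = (\<Sum>i<?n. A $$ (i, 0) * cofactor A i 0)"
    by (rule laplace_expansion_column[of _ ?n]) (auto simp: A_def)
  also have "\<dots> = (\<Sum>i\<in>{0, 1}. A $$ (i, 0) * cofactor A i 0)"
    by (rule sum.mono_neutral_right) (use assms in \<open>auto simp: A_def\<close>)
  also have "\<dots> = a 1 1 * cofactor A 0 0 + a 2 1 * cofactor A 1 0"
    by (simp add: A_def numeral_2_eq_2)
  also have "mat_delete A 0 0 = mat (Suc m) (Suc m) (\<lambda>(i, j). a (Suc (i + 1)) (Suc (j + 1)))"
    by (rule eq_matI) (auto simp: A_def mat_delete_def)
  then have "cofactor A 0 0 = det1 (Suc m) (\<lambda>i j. a (Suc i) (Suc j))"
    by (simp add: cofactor_def det1_def)
  also have "mat_delete A 1 0 = mat (Suc m) (Suc m)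
      (\<lambda>(i, j). a (if i + 1 = 1 then 1 else Suc (i + 1)) (Suc (j + 1)))"
    by (rule eq_matI) (auto simp: A_def mat_delete_def)
  then have "cofactor A 1 0 = - det1 (Suc m) (\<lambda>i j. a (if i = 1 then 1 else Suc i) (Suc j))"
    by (simp add: cofactor_def det1_def)
  finally show ?thesis
    by (simp add: det1_def A_def)
qed

lemma det1_mult:
  "det1 n a * det1 n b = det1 n (\<lambda>i j. \<Sum>p<n. a i (p + 1) * b (p + 1) j)"
proof -
  let ?A = "mat n n (\<lambda>(i, j). a (i + 1) (j + 1))"
  let ?B = "mat n n (\<lambda>(i, j). b (i + 1) (j + 1))"
  have "?A * ?B = mat n n (\<lambda>(i, j). \<Sum>p<n. a (i + 1) (p + 1) * b (p + 1) (j + 1))"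
    by (rule eq_matI) (auto simp: scalar_prod_def atLeast0LessThan)
  then show ?thesis
    unfolding det1_def by (subst det_mult[symmetric, of _ n]) auto
qed

section \<open>Partitions, conjugates and the main diagonal\<close>

lemma finite_downset_iff_le_card:
  fixes P :: "nat \<Rightarrow> bool"
  assumes fin: "finite {i. 1 \<le> i \<and> P i}"
    and down: "\<And>i k. 1 \<le> i \<Longrightarrow> i \<le> k \<Longrightarrow> P k \<Longrightarrow> P i"
    and k: "1 \<le> k"
  shows "k \<le> card {i. 1 \<le> i \<and> P i} \<longleftrightarrow> P k"
proof
  assume "P k"
  then have "{1..k} \<subseteq> {i. 1 \<le> i \<and> P i}"
    using down by auto
  from card_mono[OF fin this] show "k \<le> card {i. 1 \<le> i \<and> P i}"
    by simp
next
  assume le: "k \<le> card {i. 1 \<le> i \<and> P i}"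
  show "P k"
  proof (rule ccontr)
    assume "\<not> P k"
    then have "{i. 1 \<le> i \<and> P i} \<subseteq> {1..<k}"
      using down k by (auto simp: not_less intro: ccontr)
    from card_mono[OF _ this] show False
      using le k by simp
  qed
qed

lemma part_antimono:
  assumes "is_partition lam" "1 \<le> i" "i \<le> k"
  shows "part lam k \<le> part lam i"
proof (cases "i < k \<and> k \<le> length lam")
  case True
  then show ?thesis
    using assms sorted_wrt_nth_less[of "(\<ge>)" lam "i - 1" "k - 1"]
    by (auto simp: is_partition_def part_def)
qed (use assms in \<open>auto simp: part_def\<close>)

text \<open>Both sides say that the diagram has a box in row \<open>k\<close> and column
  \<open>j\<close>.\<close>

lemma le_conj_part_iff:
  assumes "is_partition lam" "1 \<le> k" "1 \<le> j"
  shows "k \<le> conj_part lam j \<longleftrightarrow> j \<le> part lam k"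
proof -
  have "{i. 1 \<le> i \<and> i \<le> length lam \<and> j \<le> part lam i} = {i. 1 \<le> i \<and> j \<le> part lam i}"
    using assms(3) by (auto simp: part_def split: if_splits)
  moreover have "finite {i. 1 \<le> i \<and> j \<le> part lam i}"
    by (rule finite_subset[of _ "{..length lam}"])
       (use assms(3) in \<open>auto simp: part_def split: if_splits\<close>)
  then have "k \<le> card {i. 1 \<le> i \<and> j \<le> part lam i} \<longleftrightarrow> j \<le> part lam k"
    by (rule finite_downset_iff_le_card)
       (use assms part_antimono order_trans in \<open>blast+\<close>)
  ultimately show ?thesis
    by (simp add: conj_part_def)
qed

lemma le_diag_length_iff:
  assumes "is_partition lam" "1 \<le> k"
  shows "k \<le> diag_length lam \<longleftrightarrow> k \<le> part lam k"
  unfolding diag_length_def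
proof (rule finite_downset_iff_le_card)
  show "finite {i. 1 \<le> i \<and> i \<le> part lam i}"
    by (rule finite_subset[of _ "{..length lam}"]) (auto simp: part_def split: if_splits)
next
  fix i k assume "1 \<le> i" "i \<le> k" "k \<le> part lam k"
  then show "i \<le> part lam i"
    using part_antimono[OF assms(1), of i k] by linarith
qed (rule assms)

lemma conj_part_le_length: "conj_part lam j \<le> length lam"
proof -
  have "conj_part lam j \<le> card {1..length lam}"
    unfolding conj_part_def by (rule card_mono) auto
  then show ?thesis by simp
qed

lemma diag_length_le_length: "diag_length lam \<le> length lam"
proof -
  have "diag_length lam \<le> card {1..length lam}"
    unfolding diag_length_def by (rule card_mono) (auto simp: part_def split: if_splits)
  then show ?thesis by simp
qed

section \<open>The inverse of the matrix of \<open>h\<close>, and hook functions with negative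
  arm\<close>

context
  fixes h :: "int \<Rightarrow> int \<Rightarrow> B"
  assumes unit: "\<And>k. h k (- k) = 1"
    and vanish: "\<And>r k. k + r < 0 \<Longrightarrow> h r k = 0"
begin

text \<open>
  For \<open>c = p\<close> the determinant below is a \<open>gen_elem\<close>; leaving the first row free makes the
  statement inductive under expansion along the first column.
\<close>

lemma det1_replaced_row:
  "det1 (Suc m) (\<lambda>i j. h (p + int j) (if i = 1 then - c else - p + 1 - int i)) =
    (\<Sum>s\<le>m. (-1) ^ s * h (p + 1 + int s) (- c) *
      gen_elem h (- (p + 1 + int s)) (- (p + 1 + int m)))"
proof (induction m arbitrary: p)
  case 0
  then show ?case by (simp add: gen_elem_def)
next
  case (Suc m)
  let ?a = "\<lambda>i j. h (p + int j) (if i = 1 then - c else - p + 1 - int i)"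
  have "det1 (Suc (Suc m)) ?a =
      ?a 1 1 * det1 (Suc m) (\<lambda>i j. ?a (Suc i) (Suc j)) -
      ?a 2 1 * det1 (Suc m) (\<lambda>i j. ?a (if i = 1 then 1 else Suc i) (Suc j))"
    \<comment> \<open>In column 1, the two indices of \<open>h\<close> in row \<open>i\<close> > 1
      add up to \<open>2 - i\<close>, which is negative from row 3 on.\<close>
    by (rule det1_first_column_two) (auto intro: vanish)
  also have "?a 2 1 = 1"
    using unit[of "p + 1"] by (simp add: algebra_simps)
  also have "det1 (Suc m) (\<lambda>i j. ?a (Suc i) (Suc j)) =
      gen_elem h (- (p + 1)) (- (p + 1 + int (Suc m)))"
  proof -
    have "nat (p + 1 + int (Suc m) - (p + 1)) = Suc m"
      by simp
    then show ?thesis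
      unfolding gen_elem_def by (auto intro!: det1_cong simp: algebra_simps)
  qed
  \<comment> \<open>Without row 2 and column 1 the matrix has the same shape for
    \<open>p + 1\<close>, with the free row unchanged. The other minor is the term
    \<open>s = 0\<close>.\<close>
  also have "det1 (Suc m) (\<lambda>i j. ?a (if i = 1 then 1 else Suc i) (Suc j)) =
      det1 (Suc m) (\<lambda>i j. h ((p + 1) + int j) (if i = 1 then - c else - (p + 1) + 1 - int i))"
    by (rule det1_cong) (auto simp: algebra_simps)
  also note Suc.IH[of "p + 1"]
  finally show ?case
    by (subst sum.atMost_Suc_shift) (simp add: algebra_simps sum_negf)
qed

text \<open>\<open>gen_elem h (- p) (- q)\<close> is the minor of \<open>U\<close> with rows
  \<open>p..q-1\<close> and columns \<open>p+1..q\<close>, so this is the cofactor formula for the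
  inverse of a unitriangular matrix. The term \<open>p = c\<close> is cancelled by the rest.\<close>

lemma gen_elem_inverse:
  assumes "c < q"
  shows "(\<Sum>p\<in>{c..q}. (-1) ^ nat (p - c) * h p (- c) * gen_elem h (- p) (- q)) = 0"
proof -
  define m where "m = nat (q - c - 1)"
  have q: "q = c + 1 + int m"
    using assms by (simp add: m_def)
  have "gen_elem h (- c) (- q) =
      det1 (Suc m) (\<lambda>i j. h (c + int j) (if i = 1 then - c else - c + 1 - int i))"
    unfolding gen_elem_def using q
    by (auto simp: nat_add_distrib intro!: det1_cong)
  also have "\<dots> = (\<Sum>s\<le>m. (-1) ^ s * h (c + 1 + int s) (- c) *
      gen_elem h (- (c + 1 + int s)) (- q))"
    unfolding q by (rule det1_replaced_row)
  also have "\<dots> = (\<Sum>p\<in>{c+1..q}. (-1) ^ nat (p - c - 1) * h p (- c) * gen_elem h (- p) (- q))"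
    by (rule sum.reindex_bij_witness[of _ "\<lambda>p. nat (p - c - 1)" "\<lambda>s. c + 1 + int s"])
       (auto simp: q)
  also have "\<dots> = - (\<Sum>p\<in>{c+1..q}. (-1) ^ nat (p - c) * h p (- c) * gen_elem h (- p) (- q))"
  proof -
    have "(-1) ^ nat (p - c) = - ((-1) ^ nat (p - c - 1) :: B)" if "p \<in> {c+1..q}" for p
    proof -
      have "nat (p - c) = Suc (nat (p - c - 1))"
        using that unfolding atLeastAtMost_iff by linarith
      then show ?thesis by simp
    qed
    then show ?thesis
      by (simp add: sum_negf)
  qed
  finally have *: "gen_elem h (- c) (- q) = \<dots>" .
  have "{c..q} = insert c {c+1..q}"
    using assms by auto
  then show ?thesis
    using * unit[of c] by simp
qed

text \<open>The terms with \<open>p < c\<close> vanish. The rest is \<open>(-1)^c\<close> times the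
  sum in \<open>gen_elem_inverse\<close> if \<open>c < q\<close>, a single term if
  \<open>q = c\<close>, and empty if \<open>q < c\<close>.\<close>

lemma hook_schur_neg:
  assumes "0 \<le> c" "0 \<le> q"
  shows "hook_schur h (- c - 1) q = (if q = c then (-1) ^ nat q else 0)"
proof -
  have "hook_schur h (- c - 1) q =
      (\<Sum>p\<in>{c..q}. (-1) ^ nat p * h p (- c) * gen_elem h (- p) (- q))"
    unfolding hook_schur_def using assms
    by (intro sum.mono_neutral_cong_right) (auto intro: vanish)
  also have "\<dots> = (if q = c then (-1) ^ nat q else 0)"
  proof (cases "c < q")
    case True
    have "(\<Sum>p\<in>{c..q}. (-1) ^ nat p * h p (- c) * gen_elem h (- p) (- q)) =
        (-1) ^ nat c *
        (\<Sum>p\<in>{c..q}. (-1) ^ nat (p - c) * h p (- c) * gen_elem h (- p) (- q))"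
      unfolding sum_distrib_left
    proof (rule sum.cong)
      fix p assume "p \<in> {c..q}"
      then have "nat p = nat c + nat (p - c)"
        using assms by (simp flip: nat_add_distrib)
      then show "(-1) ^ nat p * h p (- c) * gen_elem h (- p) (- q) =
          (-1) ^ nat c * ((-1) ^ nat (p - c) * h p (- c) * gen_elem h (- p) (- q))"
        by (simp add: power_add mult.assoc)
    qed simp
    then show ?thesis
      using True gen_elem_inverse[OF True] by simp
  next
    case False
    then show ?thesis
      using unit[of c] by (cases "q = c") (auto simp: gen_elem_def)
  qed
  finally show ?thesis .
qed

section \<open>The determinant of size \<open>n\<close>\<close>

text \<open>Entries with \<open>i + j > n + 1\<close> vanish and the antidiagonal ones are
  \<open>(-1)^(i-1)\<close>; their product cancels the sign of the order-reversing
  permutation.\<close>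

lemma det1_antitriangular:
  "det1 n (\<lambda>i j. (-1) ^ (i - 1) * gen_elem h (1 - int i) (int j - int n)) = 1"
proof (induction n)
  case (Suc n)
  let ?a = "\<lambda>i j. (-1) ^ (i - 1) * gen_elem h (1 - int i) (int j - int (Suc n))"
  have "det1 (Suc n) ?a = (-1) ^ (Suc n + 1) * ?a (Suc n) 1 *
      det1 n (\<lambda>i j. ?a i (if j < 1 then j else Suc j))"
    by (rule det1_last_row_single) (auto simp: gen_elem_def)
  also have "?a (Suc n) 1 = (-1) ^ n"
    by (simp add: gen_elem_def)
  \<comment> \<open>Only \<open>j - n\<close> enters, so deleting column 1 gives the matrix of size
    \<open>n\<close>.\<close>
  also have "det1 n (\<lambda>i j. ?a i (if j < 1 then j else Suc j)) =
      det1 n (\<lambda>i j. (-1) ^ (i - 1) * gen_elem h (1 - int i) (int j - int n))"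
    by (rule det1_cong) auto
  also note Suc.IH
  finally show ?case
    by (simp flip: power_add)
qed simp

text \<open>A zero part appends a last row that is 0 except for a final 1.\<close>

lemma gen_schur_padded:
  assumes "length lam \<le> n"
  shows "gen_schur h lam = det1 n (\<lambda>i j. h (int j - 1) (int (part lam i) - int i + 1))"
  using assms
proof (induction n rule: dec_induct)
  case base
  then show ?case by (simp add: gen_schur_def)
next
  case (step n)
  let ?a = "\<lambda>i j. h (int j - 1) (int (part lam i) - int i + 1)"
  have 0: "part lam (Suc n) = 0"
    using step.hyps by (simp add: part_def)
  have "det1 (Suc n) ?a = (-1) ^ (Suc n + Suc n) * ?a (Suc n) (Suc n) *
      det1 n (\<lambda>i j. ?a i (if j < Suc n then j else Suc j))"
    by (rule det1_last_row_single) (auto simp: 0 intro: vanish)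
  also have "?a (Suc n) (Suc n) = 1"
    using unit[of "int n"] by (simp add: 0)
  also have "det1 n (\<lambda>i j. ?a i (if j < Suc n then j else Suc j)) = det1 n ?a"
    by (rule det1_cong) auto
  finally show ?case
    using step.IH by simp
qed

lemma gen_schur_eq_det_hook:
  assumes "length lam \<le> n"
  shows "gen_schur h lam =
    det1 n (\<lambda>i j. hook_schur h (int (part lam i) - int i) (int n - int j))"
proof -
  let ?A = "\<lambda>i j. h (int j - 1) (int (part lam i) - int i + 1)"
  let ?W = "\<lambda>i j. (-1) ^ (i - 1) * gen_elem h (1 - int i) (int j - int n)"
  have "gen_schur h lam = det1 n ?A * det1 n ?W"
    using gen_schur_padded[OF assms] det1_antitriangular by simp
  also have "\<dots> = det1 n (\<lambda>i j. \<Sum>p<n. ?A i (p + 1) * ?W (p + 1) j)"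
    by (rule det1_mult)
  also have "\<dots> = det1 n (\<lambda>i j. hook_schur h (int (part lam i) - int i) (int n - int j))"
  proof (rule det1_cong)
    fix i j assume j: "1 \<le> j" "j \<le> n"
    \<comment> \<open>\<open>gen_elem h (- p) (j - n)\<close> is 0 for \<open>p > n - j\<close>,
      which is the upper limit of the hook sum.\<close>
    have "(\<Sum>p<n. ?A i (p + 1) * ?W (p + 1) j) = (\<Sum>p\<le>n - j. ?A i (p + 1) * ?W (p + 1) j)"
      using j by (intro sum.mono_neutral_right) (auto simp: gen_elem_def)
    also have "\<dots> = hook_schur h (int (part lam i) - int i) (int n - int j)"
      unfolding hook_schur_def using j
      by (intro sum.reindex_bij_witness[of _ nat int]) (auto simp: mult_ac)
    finally show "(\<Sum>p<n. ?A i (p + 1) * ?W (p + 1) j) =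
      hook_schur h (int (part lam i) - int i) (int n - int j)" .
  qed
  finally show ?thesis .
qed

section \<open>Descent to the Frobenius determinant\<close>

text \<open>The matrices \<open>a k\<close> interpolate between the two determinants: the maximum is
  \<open>k\<close> when \<open>k\<close> is at least the length, and \<open>conj_part lam j\<close>
  when \<open>k\<close> is the diagonal length and \<open>j \<le> k\<close>.\<close>

lemma det_hook_reduce:
  assumes lam: "is_partition lam" and k: "diag_length lam \<le> k"
  defines "a \<equiv> \<lambda>k i j. hook_schur h (int (part lam i) - int i)
                         (int (max k (conj_part lam j)) - int j)"
  shows "det1 (Suc k) (a (Suc k)) = det1 k (a k)"
proof -
  let ?K = "Suc k"
  \<comment> \<open>The arm index of row \<open>?K\<close> is \<open>- (?K - c) - 1\<close>, so its
    nonzero entry has leg index \<open>?K - c\<close>. Columns \<open>j < c\<close> have leg index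
    at least \<open>?K - j\<close>, the others exactly \<open>?K - j\<close>; only
    \<open>j = c\<close> fits.\<close>
  define c where "c = Suc (part lam ?K)"
  have less: "part lam ?K < ?K"
    using le_diag_length_iff[OF lam, of ?K] k by simp
  have conj: "?K \<le> conj_part lam j \<longleftrightarrow> j < c" if "1 \<le> j" for j
    using le_conj_part_iff[OF lam, of ?K j] that by (auto simp: c_def)
  have row: "a ?K ?K j = (if j = c then (-1) ^ (?K - c) else 0)" if j: "1 \<le> j" "j \<le> ?K" for j
  proof -
    let ?q = "int (max ?K (conj_part lam j)) - int j"
    have "a ?K ?K j = hook_schur h (- (int ?K - int c) - 1) ?q"
      by (simp add: a_def c_def algebra_simps)
    also have "\<dots> = (if ?q = int ?K - int c then (-1) ^ nat ?q else 0)"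
      by (rule hook_schur_neg) (use less j in \<open>auto simp: c_def\<close>)
    also have "?q = int ?K - int c \<longleftrightarrow> j = c"
      using conj[OF j(1)] by (cases "j < c") auto
    finally have "a ?K ?K j = (if j = c then (-1) ^ nat ?q else 0)" .
    moreover have "nat ?q = ?K - c" if "j = c"
      using conj[OF j(1)] that by linarith
    ultimately show ?thesis
      by simp
  qed
  have "det1 ?K (a ?K) = (-1) ^ (?K + c) * a ?K ?K c *
      det1 k (\<lambda>i j. a ?K i (if j < c then j else Suc j))"
    by (rule det1_last_row_single) (use less row in \<open>auto simp: c_def\<close>)
  also have "a ?K ?K c = (-1) ^ (?K - c)"
    using row[of c] less by (auto simp: c_def)
  also have "(-1) ^ (?K + c) * (-1) ^ (?K - c) = (1 :: B)"
    using less by (simp add: c_def flip: power_add)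
  also have "det1 k (\<lambda>i j. a ?K i (if j < c then j else Suc j)) = det1 k (a k)"
  proof (rule det1_cong)
    fix i j :: nat assume j: "1 \<le> j"
    let ?j = "if j < c then j else Suc j"
    \<comment> \<open>For \<open>j < c\<close> both maxima are \<open>conj_part lam j\<close>. For
      \<open>j \<ge> c\<close> they are \<open>?K\<close> and \<open>k\<close>, and the shift to
      \<open>Suc j\<close> makes up the difference.\<close>
    have "int (max ?K (conj_part lam ?j)) - int ?j = int (max k (conj_part lam j)) - int j"
      using conj[of j] conj[of "Suc j"] j by (cases "j < c") auto
    then show "a ?K i ?j = a k i j"
      by (simp only: a_def)
  qed
  finally show ?thesis by simp
qed

lemma det_hook_frobenius:
  assumes lam: "is_partition lam" and n: "length lam \<le> n"
  shows "det1 n (\<lambda>i j. hook_schur h (int (part lam i) - int i) (int n - int j)) =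
    det1 (diag_length lam) (\<lambda>i j. hook_schur h (frob_arm lam i) (frob_leg lam j))"
proof -
  let ?r = "diag_length lam"
  let ?a = "\<lambda>k i j. hook_schur h (int (part lam i) - int i)
                      (int (max k (conj_part lam j)) - int j)"
  have "?r \<le> n"
    using diag_length_le_length[of lam] n by simp
  then have "det1 n (?a n) = det1 ?r (?a ?r)"
    by (induction n rule: dec_induct) (simp_all only: det_hook_reduce[OF lam])
  moreover have "det1 n (?a n) =
      det1 n (\<lambda>i j. hook_schur h (int (part lam i) - int i) (int n - int j))"
    by (rule det1_cong) (simp add: max_absorb1 order_trans[OF conj_part_le_length n])
  moreover have "det1 ?r (?a ?r) =
      det1 ?r (\<lambda>i j. hook_schur h (frob_arm lam i) (frob_leg lam j))"
  proof (rule det1_cong)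
    fix i j assume j: "1 \<le> j" "j \<le> ?r"
    \<comment> \<open>The first \<open>?r\<close> rows and columns form the Durfee square, so each
      of these columns has length at least \<open>?r\<close>.\<close>
    then have "j \<le> part lam ?r"
      using le_diag_length_iff[OF lam, of ?r] by simp
    then have "?r \<le> conj_part lam j"
      using le_conj_part_iff[OF lam, of ?r j] j by simp
    then show "?a ?r i j = hook_schur h (frob_arm lam i) (frob_leg lam j)"
      by (simp add: frob_arm_def frob_leg_def max_absorb2)
  qed
  ultimately show ?thesis by simp
qed

end

theorem theorem3p1:
  fixes h :: "int \<Rightarrow> int \<Rightarrow> B" and lam :: "nat list" and n :: nat
  assumes extends: "\<And>k. h 0 k = hgen k"
    and filtered: "\<And>r k. h r k \<in> B_le (k + r)"
    and unit: "\<And>k. h k (- k) = 1"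
    and vanish: "\<And>r k. k + r < 0 \<Longrightarrow> h r k = 0"
    and basis: "basis_family (gen_schur h) {mu. is_partition mu}"
    and lam: "is_partition lam"
    and n: "length lam \<le> n"
  shows "gen_schur h lam =
           det1 n (\<lambda>i j. hook_schur h (int (part lam i) - int i) (int n - int j)) \<and>
         gen_schur h lam =
           det1 (diag_length lam) (\<lambda>i j. hook_schur h (frob_arm lam i) (frob_leg lam j))"
  using gen_schur_eq_det_hook[of h lam n, OF unit vanish n]
    det_hook_frobenius[of h lam n, OF unit vanish lam n]
  by simp

end
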